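(* Let $R$ be a topological ring that has a sequence of units converging to $0$. Let $M$ and $N$ be topological Hausdorff $R$-modules that have countable fundamental systems of open neighbourhoods of $0$. Let $M$ be complete, and let $u: M\rightarrow N$ be a continuous $R$-linear map. Then the following properties are equivalent: 1) $N$ is complete and $u$ is surjective. 1a) $N$ is complete and $u(M)$ is open in $N$. 2) $u(M)\subseteq N$ is not meagre in $N$. 3) For all neighbourhoods $V$ of $0$ in $M$, the closure $\overline{u(V)}$ (taken in $N$) is a neighbourhood of $0$ in $N$. 4) $u$ is open.
   Context: Rings have a $1$ and are not necessarily commutative; an $R$-module is a left $R$-module. A Cauchy sequence in a topological group $G$ with neutral element $e$ is a sequence $(x_n)_{n\in\mathbb{N}}$ such that for every neighbourhood $V$ of $e$ there is an $N_0\in\mathbb{N}$ with $x_m\cdot x_k^{-1}\in V$ for all $m,k\geq N_0$. A topological group having a countable fundamental system of open neighbourhoods of its neutral element is called complete if every Cauchy sequence in it converges in it. A topological Hausdorff module with a countable fundamental system of open neighbourhoods of $0$ is called complete if its additive group is complete. *)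

theory Defs
  imports "HOL-Analysis.Analysis"
begin

text \<open>
  Rings, modules and their topologies are carried by types. A topological ring is a type of sort
  \<open>{ring, monoid_mult, topological_ab_group_add, topological_semigroup_mult}\<close>: unlike \<open>ring_1\<close>,
  this sort does not exclude the zero ring. It imposes neither commutativity nor the Hausdorff
  property.
\<close>

definition ring_unit :: "'a::monoid_mult \<Rightarrow> bool"
  where "ring_unit a \<longleftrightarrow> (\<exists>b. a * b = 1 \<and> b * a = 1)"

text \<open>The library locale \<open>module\<close> is restricted to commutative scalar rings.\<close>

locale left_module =
  fixes scale :: "'r::{ring, monoid_mult} \<Rightarrow> 'm::ab_group_add \<Rightarrow> 'm"
  assumes scale_right_distrib: "scale a (x + y) = scale a x + scale a y"
    and scale_left_distrib: "scale (a + b) x = scale a x + scale b x"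
    and scale_scale: "scale a (scale b x) = scale (a * b) x"
    and scale_one: "scale 1 x = x"

locale topological_module = left_module scale
  for scale :: "'r::{ring, monoid_mult, topological_ab_group_add, topological_semigroup_mult}
    \<Rightarrow> 'm::topological_ab_group_add \<Rightarrow> 'm" +
  assumes continuous_scale: "continuous_on UNIV (\<lambda>(a, x). scale a x)"

definition module_linear ::
  "('r \<Rightarrow> 'm::ab_group_add \<Rightarrow> 'm) \<Rightarrow> ('r \<Rightarrow> 'n::ab_group_add \<Rightarrow> 'n) \<Rightarrow> ('m \<Rightarrow> 'n) \<Rightarrow> bool"
  where "module_linear scaleM scaleN u \<longleftrightarrow>
    (\<forall>x y. u (x + y) = u x + u y) \<and> (\<forall>a x. u (scaleM a x) = scaleN a (u x))"

definition neighbourhood :: "'a::topological_space \<Rightarrow> 'a set \<Rightarrow> bool"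
  where "neighbourhood x V \<longleftrightarrow> (\<exists>U. open U \<and> x \<in> U \<and> U \<subseteq> V)"

definition countable_neighbourhood_base :: "'a::topological_space \<Rightarrow> bool"
  where "countable_neighbourhood_base x \<longleftrightarrow>
    (\<exists>B. countable B \<and> (\<forall>U\<in>B. open U \<and> x \<in> U) \<and>
      (\<forall>V. neighbourhood x V \<longrightarrow> (\<exists>U\<in>B. U \<subseteq> V)))"

text \<open>
  The library notions \<open>Cauchy\<close> and \<open>complete\<close> refer to a chosen uniformity or metric, whereas these
  depend only on the group and its topology.
\<close>

definition group_Cauchy :: "(nat \<Rightarrow> 'a::topological_group_add) \<Rightarrow> bool"
  where "group_Cauchy X \<longleftrightarrow>
    (\<forall>V. neighbourhood 0 V \<longrightarrow> (\<exists>N0. \<forall>m\<ge>N0. \<forall>k\<ge>N0. X m - X k \<in> V))"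

text \<open>Sequential completeness; only appropriate for groups with a countable base at \<open>0\<close>.\<close>

definition group_complete :: "'a::topological_group_add itself \<Rightarrow> bool"
  where "group_complete _ \<longleftrightarrow> (\<forall>X :: nat \<Rightarrow> 'a. group_Cauchy X \<longrightarrow> convergent X)"

definition nowhere_dense :: "'a::topological_space set \<Rightarrow> bool"
  where "nowhere_dense A \<longleftrightarrow> interior (closure A) = {}"

definition meagre :: "'a::topological_space set \<Rightarrow> bool"
  where "meagre A \<longleftrightarrow> (\<exists>F. countable F \<and> (\<forall>S\<in>F. nowhere_dense S) \<and> A = \<Union>F)"

end

theory Submission
  imports Defs
begin

text \<open>
  The theorem is the Banach--Schauder theorem, freed from metrics and from norms.

  Two ingredients replace the metric. A countable neighbourhood base of \<open>0\<close> can be thinned to a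
  sequence \<open>V 0, V 1, \<dots>\<close> of symmetric open sets with \<open>V (k + 1) + V (k + 1) \<subseteq> V k\<close>
  (\<open>halving_base_exists\<close>). It plays the part of the balls of radius \<open>2\<^sup>-\<^sup>k\<close>: a sequence whose
  \<open>k\<close>-th increment lies in \<open>V (k + 1)\<close> is Cauchy and moves by no more than \<open>V 0\<close>.
  The null sequence of units \<open>r\<close> replaces dilations: every neighbourhood \<open>W\<close> of \<open>0\<close> is
  absorbing in the sense that the sets \<open>r\<^sub>i\<^sup>-\<^sup>1 W\<close> cover the module (\<open>null_units_absorb\<close>), and
  multiplication by a unit is a homeomorphism.

  Properties 1 and 1a agree because an open submodule absorbs everything. The remaining
  implications go round in a circle.

  From 1 to 2 one needs Baire's theorem for complete groups
  (\<open>complete_group_not_meagre\<close>). From 2 to 3, the range of \<open>u\<close> is the countable union of the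
  sets \<open>r\<^sub>i\<^sup>-\<^sup>1 u(W)\<close>; if it is not meagre, then the closure of \<open>u(W)\<close> has an interior
  point in \<open>u(W)\<close>, and moving that point to \<open>0\<close> yields a neighbourhood of \<open>0\<close>
  (\<open>nonmeagre_range_nearly_open\<close>). From 3 to 4, a point in the closure of \<open>u(V)\<close> is hit
  exactly by successive approximation, which converges since \<open>M\<close> is complete
  (\<open>nearly_open_imp_open\<close>). From 4 to 1, increments of a rapidly converging subsequence in
  \<open>N\<close> are lifted to small elements of \<open>M\<close>, whose sums converge (\<open>complete_open_image\<close>).
\<close>

section \<open>Neighbourhoods in topological abelian groups\<close>

lemma open_minus_const:
  fixes U :: "'a::topological_ab_group_add set"
  assumes "open U"
  shows "open {z. z - y \<in> U}"
proof -
  have "open ((\<lambda>z. z - y) -` U)"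
    by (rule open_vimage[OF assms]) (intro continuous_intros)
  then show ?thesis by (simp add: vimage_def)
qed

lemma open_const_minus:
  fixes U :: "'a::topological_ab_group_add set"
  assumes "open U"
  shows "open {z. y - z \<in> U}"
proof -
  have "open ((\<lambda>z. y - z) -` U)"
    by (rule open_vimage[OF assms]) (intro continuous_intros)
  then show ?thesis by (simp add: vimage_def)
qed

lemma closure_approx_group:
  fixes S :: "'a::topological_ab_group_add set"
  assumes y: "y \<in> closure S" and U: "neighbourhood 0 U"
  obtains s where "s \<in> S" "y - s \<in> U"
proof -
  obtain U' where U': "open U'" "0 \<in> U'" "U' \<subseteq> U"
    using U unfolding neighbourhood_def by blast
  have "{z. y - z \<in> U'} \<inter> closure S \<noteq> {}"
    using y U' by (intro ex_in_conv[THEN iffD1] exI[of _ y]) simp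
  then have "{z. y - z \<in> U'} \<inter> S \<noteq> {}"
    using open_Int_closure_eq_empty[OF open_const_minus[OF U'(1)]] by blast
  then show ?thesis using U' that by auto
qed

lemma neighbourhood_Int:
  assumes "neighbourhood x U" "neighbourhood x V"
  shows "neighbourhood x (U \<inter> V)"
proof -
  obtain A B where "open A" "x \<in> A" "A \<subseteq> U" "open B" "x \<in> B" "B \<subseteq> V"
    using assms unfolding neighbourhood_def by blast
  then show ?thesis
    unfolding neighbourhood_def by (intro exI[of _ "A \<inter> B"]) auto
qed

lemma open_imp_neighbourhood: "open U \<Longrightarrow> x \<in> U \<Longrightarrow> neighbourhood x U"
  unfolding neighbourhood_def by blast

lemma symmetric_halving_neighbourhood:
  fixes U :: "'a::topological_ab_group_add set"
  assumes "open U" "0 \<in> U"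
  obtains W where "open W" "0 \<in> W" "\<And>a. a \<in> W \<Longrightarrow> - a \<in> W"
    "\<And>a b. a \<in> W \<Longrightarrow> b \<in> W \<Longrightarrow> a + b \<in> U"
proof -
  have "continuous_on UNIV (\<lambda>p::'a \<times> 'a. fst p + snd p)"
    by (intro continuous_intros)
  then have "open ((\<lambda>p::'a \<times> 'a. fst p + snd p) -` U)"
    by (rule open_vimage[OF assms(1)])
  moreover have "(0, 0) \<in> (\<lambda>p::'a \<times> 'a. fst p + snd p) -` U"
    using assms(2) by simp
  ultimately obtain A B where AB: "open A" "open B" "(0, 0) \<in> A \<times> B"
    "A \<times> B \<subseteq> (\<lambda>p::'a \<times> 'a. fst p + snd p) -` U"
    by (elim open_prod_elim)
  define C where "C = A \<inter> B"
  have C: "open C" "0 \<in> C" using AB by (auto simp: C_def)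
  have "open {z. 0 - z \<in> C}" by (rule open_const_minus[OF C(1)])
  then have "open (C \<inter> {z. - z \<in> C})" using C(1) by auto
  moreover have "a + b \<in> U" if "a \<in> C" "b \<in> C" for a b
    using that AB(4) by (auto simp: C_def)
  ultimately show ?thesis
    using C by (intro that[of "C \<inter> {z. - z \<in> C}"]) auto
qed

locale halving_base =
  fixes V :: "nat \<Rightarrow> 'a::topological_ab_group_add set"
  assumes open_base: "open (V k)"
    and zero_in_base: "0 \<in> V k"
    and minus_in_base: "a \<in> V k \<Longrightarrow> - a \<in> V k"
    and add_in_base: "a \<in> V (Suc k) \<Longrightarrow> b \<in> V (Suc k) \<Longrightarrow> a + b \<in> V k"
    and base_small: "neighbourhood 0 U \<Longrightarrow> \<exists>k. V k \<subseteq> U"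
begin

lemma neighbourhood_base: "neighbourhood 0 (V k)"
  by (simp add: open_imp_neighbourhood open_base zero_in_base)

lemma base_decreasing: "k \<le> l \<Longrightarrow> V l \<subseteq> V k"
proof (rule lift_Suc_antimono_le[of V])
  show "V (Suc n) \<subseteq> V n" for n
    using add_in_base[OF _ zero_in_base] by force
qed

lemma closure_base: "closure (V (Suc k)) \<subseteq> V k"
proof
  fix y assume "y \<in> closure (V (Suc k))"
  then obtain s where "s \<in> V (Suc k)" "y - s \<in> V (Suc k)"
    using closure_approx_group neighbourhood_base by metis
  then show "y \<in> V k" using add_in_base[of "y - s" k s] by simp
qed

lemma telescope_in_base:
  assumes s: "\<And>k. s (Suc k) - s k \<in> V (Suc k)" and "m \<le> n"
  shows "s n - s m \<in> V m"
  using \<open>m \<le> n\<close>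
proof (induction rule: inc_induct)
  case base
  then show ?case by (simp add: zero_in_base)
next
  case (step m)
  then show ?case
    using add_in_base[OF step.IH s[of m]] by simp
qed

lemma telescope_Cauchy:
  assumes s: "\<And>k. s (Suc k) - s k \<in> V (Suc k)"
  shows "group_Cauchy s"
  unfolding group_Cauchy_def
proof (intro allI impI)
  fix U :: "'a set" assume "neighbourhood 0 U"
  then obtain N where N: "V N \<subseteq> U" using base_small by blast
  have "s m - s k \<in> V N" if "N \<le> m" "N \<le> k" for m k
  proof (cases "k \<le> m")
    case True
    then show ?thesis
      using telescope_in_base[of s k m, OF s] base_decreasing[OF that(2)] by blast
  next
    case False
    then have "s k - s m \<in> V N"
      using telescope_in_base[of s m k, OF s] base_decreasing[OF that(1)] by force
    from minus_in_base[OF this] show ?thesis by simp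
  qed
  then show "\<exists>N0. \<forall>m\<ge>N0. \<forall>k\<ge>N0. s m - s k \<in> U" using N by blast
qed

text \<open>
  This is the analogue of the convergence of a series dominated by \<open>\<Sum>2\<^sup>-\<^sup>k\<close>. The location
  of the limit matters as much as its existence: it keeps the preimages found by successive
  approximation inside a given neighbourhood.
\<close>

lemma telescope_limit:
  assumes "group_complete TYPE('a)" and s: "\<And>k. s (Suc k) - s k \<in> V (Suc k)"
  obtains l where "s \<longlonglongrightarrow> l" "l - s 0 \<in> closure (V 0)"
proof -
  obtain l where l: "s \<longlonglongrightarrow> l"
    using assms(1) telescope_Cauchy[OF s] unfolding group_complete_def convergent_def by blast
  have "s n - s 0 \<in> closure (V 0)" for n
    using telescope_in_base[of s 0 n, OF s] closure_subset by blast
  moreover have "(\<lambda>n. s n - s 0) \<longlonglongrightarrow> l - s 0"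
    by (intro tendsto_intros l)
  ultimately have "l - s 0 \<in> closure (V 0)"
    by (rule closed_sequentially[OF closed_closure])
  with l show ?thesis by (rule that)
qed

end

text \<open>
  Each new set is chosen inside the next member of an enumerated base. Prescribing a set that
  contains the whole sequence costs nothing and spares reindexing later.
\<close>

lemma halving_base_exists:
  fixes U :: "'a::topological_ab_group_add set"
  assumes "countable_neighbourhood_base (0::'a)" and "neighbourhood 0 U"
  obtains V where "halving_base V" "closure (V 0) \<subseteq> U"
proof -
  obtain B where B: "countable B" "\<And>C. C \<in> B \<Longrightarrow> open C \<and> (0::'a) \<in> C"
    "\<And>C. neighbourhood 0 C \<Longrightarrow> \<exists>D\<in>B. D \<subseteq> C"
    using assms(1) unfolding countable_neighbourhood_base_def by blast
  obtain U' where U': "open U'" "0 \<in> U'" "U' \<subseteq> U"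
    using assms(2) unfolding neighbourhood_def by blast
  have "B \<noteq> {}" using B(3)[OF assms(2)] by blast
  then have G: "open (from_nat_into B n)" "0 \<in> from_nat_into B n" for n
    using B(2)[OF from_nat_into[of B n]] by auto
  have "\<exists>V. \<forall>n. (open (V n) \<and> 0 \<in> V n \<and> (\<forall>a\<in>V n. - a \<in> V n) \<and> V n \<subseteq> from_nat_into B n \<inter> U')
      \<and> (\<forall>a\<in>V (Suc n). \<forall>b\<in>V (Suc n). a + b \<in> V n)"
  proof (rule dependent_nat_choice)
    have "open (from_nat_into B 0 \<inter> U')" "0 \<in> from_nat_into B 0 \<inter> U'" using G U' by auto
    then obtain W where W: "open W" "0 \<in> W" "\<And>a. a \<in> W \<Longrightarrow> - a \<in> W"
      "\<And>a b. a \<in> W \<Longrightarrow> b \<in> W \<Longrightarrow> a + b \<in> from_nat_into B 0 \<inter> U'"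
      by (rule symmetric_halving_neighbourhood) auto
    have "W \<subseteq> from_nat_into B 0 \<inter> U'" using W(4)[OF _ W(2)] by auto
    then show "\<exists>W. open W \<and> 0 \<in> W \<and> (\<forall>a\<in>W. - a \<in> W) \<and> W \<subseteq> from_nat_into B 0 \<inter> U'"
      using W(1-3) by (intro exI[of _ W] conjI ballI)
  next
    fix X n
    assume X: "open X \<and> 0 \<in> X \<and> (\<forall>a\<in>X. - a \<in> X) \<and> X \<subseteq> from_nat_into B n \<inter> U'"
    let ?Y = "from_nat_into B (Suc n) \<inter> X"
    have "open ?Y" "0 \<in> ?Y" using G X by auto
    then obtain W where W: "open W" "0 \<in> W" "\<And>a. a \<in> W \<Longrightarrow> - a \<in> W"
      "\<And>a b. a \<in> W \<Longrightarrow> b \<in> W \<Longrightarrow> a + b \<in> ?Y"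
      by (rule symmetric_halving_neighbourhood) auto
    have "W \<subseteq> ?Y" using W(4)[OF _ W(2)] by auto
    then show "\<exists>W. (open W \<and> 0 \<in> W \<and> (\<forall>a\<in>W. - a \<in> W) \<and> W \<subseteq> from_nat_into B (Suc n) \<inter> U')
        \<and> (\<forall>a\<in>W. \<forall>b\<in>W. a + b \<in> X)"
      using W X by (intro exI[of _ W] conjI ballI) auto
  qed
  then obtain V where "\<forall>n. (open (V n) \<and> 0 \<in> V n \<and> (\<forall>a\<in>V n. - a \<in> V n) \<and>
      V n \<subseteq> from_nat_into B n \<inter> U') \<and> (\<forall>a\<in>V (Suc n). \<forall>b\<in>V (Suc n). a + b \<in> V n)" ..
  then have V: "open (V n)" "0 \<in> V n" "a \<in> V n \<Longrightarrow> - a \<in> V n"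
    "V n \<subseteq> from_nat_into B n" "V n \<subseteq> U'"
    "a \<in> V (Suc n) \<Longrightarrow> b \<in> V (Suc n) \<Longrightarrow> a + b \<in> V n" for n a b
    by simp_all
  have small: "\<exists>k. V k \<subseteq> C" if "neighbourhood 0 C" for C
  proof -
    obtain D where "D \<in> B" "D \<subseteq> C" using B(3) \<open>neighbourhood 0 C\<close> by blast
    moreover obtain k where "from_nat_into B k = D"
      using from_nat_into_surj[OF B(1) \<open>D \<in> B\<close>] by blast
    ultimately show ?thesis using V(4)[of k] by auto
  qed
  interpret halving_base V
    by unfold_locales (rule V small | assumption)+
  (* The first set is dropped so that even its closure fits into U. *)
  have "halving_base (\<lambda>k. V (Suc k))"
  proof (unfold_locales, goal_cases)
    case (5 C)
    then obtain k where "V k \<subseteq> C" using small by blast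
    then show ?case using base_decreasing[of k "Suc k"] by (intro exI[of _ k]) auto
  qed (rule V | assumption)+
  moreover have "closure (V (Suc 0)) \<subseteq> U"
    using closure_base[of 0] V(5)[of 0] U'(3) by blast
  ultimately show ?thesis by (rule that)
qed

section \<open>The category theorem for complete groups\<close>

text \<open>
  The classical nested-ball construction: the translates \<open>x\<^sub>n + W\<^sub>j\<close> with \<open>j \<ge> n\<close> are nested
  and the closure of the \<open>(n + 1)\<close>-st avoids the \<open>n\<close>-th nowhere dense set, so the limit of
  the centres lies in none of these sets.
\<close>

lemma complete_group_not_meagre:
  assumes base: "countable_neighbourhood_base (0::'a::topological_ab_group_add)"
    and complete: "group_complete TYPE('a)"
  shows "\<not> meagre (UNIV :: 'a set)"
proof
  assume "meagre (UNIV :: 'a set)"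
  then obtain F where F: "countable F" "\<And>S. S \<in> F \<Longrightarrow> nowhere_dense S" "(UNIV :: 'a set) = \<Union>F"
    unfolding meagre_def by blast
  define A where "A = from_nat_into F"
  have "F \<noteq> {}" using F(3) by auto
  then have A: "interior (closure (A n)) = {}" for n
    using F(2) from_nat_into[of F n] by (auto simp: A_def nowhere_dense_def)
  have "neighbourhood (0::'a) UNIV" by (simp add: open_imp_neighbourhood)
  then obtain W :: "nat \<Rightarrow> 'a set" where "halving_base W"
    using halving_base_exists[OF base] by metis
  then interpret halving_base W .
  have "\<exists>f :: nat \<Rightarrow> 'a \<times> nat. \<forall>n. n \<le> snd (f n) \<and>
      {z. z - fst (f (Suc n)) \<in> closure (W (snd (f (Suc n))))}
        \<subseteq> {z. z - fst (f n) \<in> W (snd (f n))} - closure (A n)"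
  proof (rule dependent_nat_choice)
    show "\<exists>p :: 'a \<times> nat. 0 \<le> snd p" by simp
  next
    fix p :: "'a \<times> nat" and n assume "n \<le> snd p"
    define O1 where "O1 = {z. z - fst p \<in> W (snd p)}"
    have O1: "open O1" "fst p \<in> O1"
      by (auto simp: O1_def intro: open_minus_const open_base zero_in_base)
    have "\<not> O1 \<subseteq> closure (A n)"
      using A[of n] O1 interior_maximal by blast
    then obtain x where x: "x \<in> O1 - closure (A n)" by blast
    have "open (O1 - closure (A n))" using O1(1) by (simp add: open_Diff)
    then have "open ((\<lambda>z. z + x) -` (O1 - closure (A n)))"
      by (rule open_vimage) (intro continuous_intros)
    then have "neighbourhood 0 ((\<lambda>z. z + x) -` (O1 - closure (A n)))"
      using x by (intro open_imp_neighbourhood) auto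
    then obtain i where i: "W i \<subseteq> (\<lambda>z. z + x) -` (O1 - closure (A n))"
      using base_small by blast
    have "closure (W (Suc (max i n))) \<subseteq> W i"
      using closure_base[of "max i n"] base_decreasing[of i "max i n"] by auto
    then have "{z. z - x \<in> closure (W (Suc (max i n)))} \<subseteq> O1 - closure (A n)"
      using i by force
    then show "\<exists>q. Suc n \<le> snd q \<and> {z. z - fst q \<in> closure (W (snd q))}
        \<subseteq> {z. z - fst p \<in> W (snd p)} - closure (A n)"
      unfolding O1_def by (intro exI[of _ "(x, Suc (max i n))"]) auto
  qed
  then obtain f :: "nat \<Rightarrow> 'a \<times> nat" where f: "\<And>n. n \<le> snd (f n)"
    and nested: "\<And>n. {z. z - fst (f (Suc n)) \<in> closure (W (snd (f (Suc n))))}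
        \<subseteq> {z. z - fst (f n) \<in> W (snd (f n))} - closure (A n)"
    by blast
  define x where "x = fst \<circ> f"
  define D where "D n = {z. z - x n \<in> W (snd (f n))}" for n
  have D_closure: "D (Suc n) \<subseteq> {z. z - x (Suc n) \<in> closure (W (snd (f (Suc n))))}" for n
    using closure_subset unfolding D_def by blast
  have "D (Suc n) \<subseteq> D n" for n
    using D_closure[of n] nested[of n] by (auto simp: D_def x_def)
  then have D_decreasing: "D m \<subseteq> D n" if "n \<le> m" for m n
    using lift_Suc_antimono_le[of D] that by blast
  have centre: "x n \<in> D n" for n by (simp add: D_def zero_in_base)
  then have near: "x m - x n \<in> W (snd (f n))" if "n \<le> m" for m n
    using subsetD[OF D_decreasing[OF that] centre[of m]] by (simp add: D_def)
  have "group_Cauchy x"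
    unfolding group_Cauchy_def
  proof (intro allI impI)
    fix U :: "'a set" assume "neighbourhood 0 U"
    then obtain k where k: "W k \<subseteq> U" using base_small by blast
    have "x m - x l \<in> W k" if "Suc k \<le> m" "Suc k \<le> l" for m l
    proof -
      have "W (snd (f (Suc k))) \<subseteq> W (Suc k)" using f base_decreasing by blast
      then have "x m - x (Suc k) \<in> W (Suc k)" "- (x l - x (Suc k)) \<in> W (Suc k)"
        using near[OF that(1)] near[OF that(2)] minus_in_base by blast+
      from add_in_base[OF this] show ?thesis by simp
    qed
    then show "\<exists>N0. \<forall>m\<ge>N0. \<forall>l\<ge>N0. x m - x l \<in> U" using k by blast
  qed
  then obtain l where l: "x \<longlonglongrightarrow> l"
    using complete unfolding group_complete_def convergent_def by blast
  have "l \<notin> A n" for n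
  proof -
    have "x (m + Suc n) - x (Suc n) \<in> closure (W (snd (f (Suc n))))" for m
      using near[of "Suc n" "m + Suc n"] closure_subset by auto
    moreover have "(\<lambda>m. x (m + Suc n) - x (Suc n)) \<longlonglongrightarrow> l - x (Suc n)"
      by (intro tendsto_intros LIMSEQ_ignore_initial_segment l)
    ultimately have "l - x (Suc n) \<in> closure (W (snd (f (Suc n))))"
      by (rule closed_sequentially[OF closed_closure])
    then have "l \<notin> closure (A n)" using nested[of n] by (auto simp: x_def)
    then show ?thesis using closure_subset by blast
  qed
  moreover obtain S where S: "S \<in> F" "l \<in> S" using F(3) by blast
  moreover obtain n where "A n = S" using from_nat_into_surj[OF F(1) S(1)] by (auto simp: A_def)
  ultimately show False by blast
qed

section \<open>Additive maps out of a complete group\<close>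

text \<open>
  A Cauchy sequence \<open>Y\<close> in the target has a subsequence whose \<open>k\<close>-th increment lies in
  \<open>u(V (k + 1))\<close>. Lifting the increments gives a convergent series in the source, so the
  subsequence converges, and hence so does \<open>Y\<close>.
\<close>

lemma complete_open_image:
  fixes u :: "'m::topological_ab_group_add \<Rightarrow> 'n::topological_ab_group_add"
  assumes base: "countable_neighbourhood_base (0::'m)"
    and complete: "group_complete TYPE('m)"
    and cont: "continuous_on UNIV u"
    and add: "\<And>x y. u (x + y) = u x + u y"
    and nbhd: "\<And>V. neighbourhood 0 V \<Longrightarrow> neighbourhood 0 (u ` V)"
  shows "group_complete TYPE('n)"
  unfolding group_complete_def
proof (intro allI impI)
  fix Y :: "nat \<Rightarrow> 'n" assume Y: "group_Cauchy Y"
  have "neighbourhood (0::'m) UNIV" by (simp add: open_imp_neighbourhood)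
  then obtain V :: "nat \<Rightarrow> 'm set" where "halving_base V"
    using halving_base_exists[OF base] by metis
  then interpret halving_base V .
  have "\<forall>k. \<exists>g. \<forall>m\<ge>g. \<forall>l\<ge>g. Y m - Y l \<in> u ` V (Suc k)"
    using Y nbhd[OF neighbourhood_base] unfolding group_Cauchy_def by blast
  then obtain g where g: "\<And>k m l. g k \<le> m \<Longrightarrow> g k \<le> l \<Longrightarrow> Y m - Y l \<in> u ` V (Suc k)"
    by metis
  (* The summand k forces n to tend to infinity, and the sum keeps it monotone. *)
  define n where "n k = k + (\<Sum>i\<le>k. g i)" for k
  have n: "k \<le> n k" "g k \<le> n k" "g k \<le> n (Suc k)" for k
    unfolding n_def using member_le_sum[of k "{..k}" g] by auto
  then have "\<forall>k. \<exists>x. x \<in> V (Suc k) \<and> Y (n (Suc k)) - Y (n k) = u x"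
    using g by (metis imageE)
  then obtain x where x: "\<And>k. x k \<in> V (Suc k)" "\<And>k. Y (n (Suc k)) - Y (n k) = u (x k)"
    by metis
  define s where "s k = (\<Sum>i<k. x i)" for k
  have "s (Suc k) - s k \<in> V (Suc k)" for k using x(1) by (simp add: s_def)
  then obtain l where l: "s \<longlonglongrightarrow> l" using telescope_limit[OF complete] by metis
  have u0: "u 0 = 0" using add[of 0 0] by simp
  have us: "u (s k) = Y (n k) - Y (n 0)" for k
  proof (induction k)
    case 0
    then show ?case by (simp add: s_def u0)
  next
    case (Suc k)
    have "u (s (Suc k)) = u (s k) + u (x k)" by (simp add: s_def add)
    then show ?case using Suc x(2)[of k] by (simp add: algebra_simps)
  qed
  have "(\<lambda>k. u (s k)) \<longlonglongrightarrow> u l"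
    using continuous_on_tendsto_compose[OF cont l] by simp
  then have sub: "(\<lambda>k. u (s k) + Y (n 0)) \<longlonglongrightarrow> u l + Y (n 0)"
    by (intro tendsto_intros)
  have gap: "(\<lambda>k. Y k - Y (n k)) \<longlonglongrightarrow> 0"
  proof (rule topological_tendstoI)
    fix S :: "'n set" assume "open S" "0 \<in> S"
    then have "neighbourhood 0 S" by (rule open_imp_neighbourhood)
    then obtain N0 where "\<forall>m\<ge>N0. \<forall>k\<ge>N0. Y m - Y k \<in> S"
      using Y unfolding group_Cauchy_def by blast
    then have "\<forall>k\<ge>N0. Y k - Y (n k) \<in> S" using n(1) by (meson order_trans)
    then show "\<forall>\<^sub>F k in sequentially. Y k - Y (n k) \<in> S"
      using eventually_sequentially by blast
  qed
  have "(\<lambda>k. (Y k - Y (n k)) + (u (s k) + Y (n 0))) \<longlonglongrightarrow> 0 + (u l + Y (n 0))"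
    by (rule tendsto_add[OF gap sub])
  then have "Y \<longlonglongrightarrow> u l + Y (n 0)" by (simp add: us)
  then show "convergent Y" by (rule convergentI)
qed

text \<open>
  Successive approximation. With \<open>y\<close> in the closure of \<open>u(V 1)\<close>, choose increments
  \<open>x\<^sub>k \<in> V (k + 1)\<close> such that the error \<open>y - u(x\<^sub>0 + \<dots> + x\<^sub>k)\<close> stays in the closure of
  \<open>u(V (k + 2))\<close>, which allows the next step, and in \<open>W k\<close>, which makes it tend to \<open>0\<close>.
  The sum of the \<open>x\<^sub>k\<close> is then an exact preimage of \<open>y\<close>, because limits in the target are unique,
  and it lies in the closure of \<open>V 0\<close>, which was chosen inside \<open>U\<close>.
\<close>

lemma nearly_open_imp_open:
  fixes u :: "'m::topological_ab_group_add \<Rightarrow> 'n::{topological_ab_group_add, t2_space}"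
  assumes baseM: "countable_neighbourhood_base (0::'m)"
    and baseN: "countable_neighbourhood_base (0::'n)"
    and complete: "group_complete TYPE('m)"
    and cont: "continuous_on UNIV u"
    and add: "\<And>x y. u (x + y) = u x + u y"
    and nearly: "\<And>V. neighbourhood 0 V \<Longrightarrow> neighbourhood 0 (closure (u ` V))"
    and U: "neighbourhood 0 U"
  shows "neighbourhood 0 (u ` U)"
proof -
  obtain V where V: "halving_base V" "closure (V 0) \<subseteq> U"
    using halving_base_exists[OF baseM U] .
  interpret V: halving_base V by (rule V)
  have "neighbourhood (0::'n) UNIV" by (simp add: open_imp_neighbourhood)
  then obtain W :: "nat \<Rightarrow> 'n set" where "halving_base W"
    using halving_base_exists[OF baseN] by metis
  then interpret W: halving_base W .
  have u0: "u 0 = 0" using add[of 0 0] by simp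
  have "closure (u ` V 1) \<subseteq> u ` U"
  proof
    fix y assume y: "y \<in> closure (u ` V 1)"
    have "\<exists>s. \<forall>k. (y - u (s k) \<in> closure (u ` V (Suc k)) \<and> (k = 0 \<longrightarrow> s k = 0)) \<and>
        (s (Suc k) - s k \<in> V (Suc k) \<and> y - u (s (Suc k)) \<in> W k)"
    proof (rule dependent_nat_choice)
      show "\<exists>a. y - u a \<in> closure (u ` V (Suc 0)) \<and> (0 = (0::nat) \<longrightarrow> a = 0)"
        using y by (intro exI[of _ 0]) (simp add: u0)
    next
      fix a and k :: nat
      assume a: "y - u a \<in> closure (u ` V (Suc k)) \<and> (k = 0 \<longrightarrow> a = 0)"
      have "neighbourhood 0 (closure (u ` V (Suc (Suc k))) \<inter> W k)"
        by (intro neighbourhood_Int nearly V.neighbourhood_base W.neighbourhood_base)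
      then obtain t where t: "t \<in> u ` V (Suc k)"
        "y - u a - t \<in> closure (u ` V (Suc (Suc k))) \<inter> W k"
        using a by (meson closure_approx_group)
      then obtain b where b: "b \<in> V (Suc k)" "t = u b" by blast
      then show "\<exists>c. (y - u c \<in> closure (u ` V (Suc (Suc k))) \<and> (Suc k = 0 \<longrightarrow> c = 0)) \<and>
          (c - a \<in> V (Suc k) \<and> y - u c \<in> W k)"
        using t by (intro exI[of _ "a + b"]) (auto simp: add algebra_simps)
    qed
    then obtain s where s: "\<And>k. s (Suc k) - s k \<in> V (Suc k)" "\<And>k. y - u (s (Suc k)) \<in> W k"
      "s 0 = 0"
      by blast
    obtain l where l: "s \<longlonglongrightarrow> l" "l - s 0 \<in> closure (V 0)"
      using V.telescope_limit[OF complete s(1)] .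
    have "(\<lambda>k. y - u (s (Suc k))) \<longlonglongrightarrow> 0"
    proof (rule topological_tendstoI)
      fix S :: "'n set" assume "open S" "0 \<in> S"
      then obtain j where "W j \<subseteq> S" using W.base_small open_imp_neighbourhood by blast
      then have "\<forall>k\<ge>j. y - u (s (Suc k)) \<in> S" using s(2) W.base_decreasing by blast
      then show "\<forall>\<^sub>F k in sequentially. y - u (s (Suc k)) \<in> S"
        using eventually_sequentially by blast
    qed
    moreover have "(\<lambda>k. y - u (s (Suc k))) \<longlonglongrightarrow> y - u l"
      using continuous_on_tendsto_compose[OF cont LIMSEQ_Suc[OF l(1)]]
      by (intro tendsto_intros) simp
    ultimately have "y - u l = 0" by (rule LIMSEQ_unique[symmetric])
    then have "y = u l" by simp
    moreover have "l \<in> U" using l(2) s(3) V(2) by auto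
    ultimately show "y \<in> u ` U" by blast
  qed
  then show ?thesis
    using nearly[OF V.neighbourhood_base[of 1]] unfolding neighbourhood_def by blast
qed

lemma open_map_iff_neighbourhood_0:
  fixes u :: "'m::topological_ab_group_add \<Rightarrow> 'n::topological_ab_group_add"
  assumes add: "\<And>x y. u (x + y) = u x + u y"
  shows "open_map euclidean euclidean u \<longleftrightarrow>
    (\<forall>V. neighbourhood 0 V \<longrightarrow> neighbourhood 0 (u ` V))"
proof -
  have u0: "u 0 = 0" using add[of 0 0] by simp
  show ?thesis
  proof
    assume om: "open_map euclidean euclidean u"
    show "\<forall>V. neighbourhood 0 V \<longrightarrow> neighbourhood 0 (u ` V)"
    proof (intro allI impI)
      fix V :: "'m set" assume "neighbourhood 0 V"
      then obtain U where "open U" "0 \<in> U" "U \<subseteq> V" unfolding neighbourhood_def by blast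
      then have "open (u ` U)" "0 \<in> u ` U" "u ` U \<subseteq> u ` V"
        using om u0 by (auto simp: open_map_def intro: image_eqI[of _ _ 0])
      then show "neighbourhood 0 (u ` V)" unfolding neighbourhood_def by blast
    qed
  next
    assume nb: "\<forall>V. neighbourhood 0 V \<longrightarrow> neighbourhood 0 (u ` V)"
    have "open (u ` U)" if U: "open U" for U
    proof (subst open_subopen, intro ballI)
      fix y assume "y \<in> u ` U"
      then obtain x where x: "x \<in> U" "y = u x" by blast
      have "open ((\<lambda>z. z + x) -` U)"
        by (rule open_vimage[OF U]) (intro continuous_intros)
      then have "neighbourhood 0 ((\<lambda>z. z + x) -` U)"
        using x by (intro open_imp_neighbourhood) auto
      then have "neighbourhood 0 (u ` ((\<lambda>z. z + x) -` U))"
        using nb by blast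
      then obtain T where T: "open T" "0 \<in> T" "T \<subseteq> u ` ((\<lambda>z. z + x) -` U)"
        unfolding neighbourhood_def by blast
      have "z \<in> u ` U" if "z - y \<in> T" for z
      proof -
        obtain w where "w + x \<in> U" "z - y = u w" using T \<open>z - y \<in> T\<close> by auto
        then show ?thesis
          using add[of w x] x by (intro image_eqI[of _ _ "w + x"]) (auto simp: algebra_simps)
      qed
      then show "\<exists>T. open T \<and> y \<in> T \<and> T \<subseteq> u ` U"
        using open_minus_const[OF T(1), of y] T(2) by (intro exI[of _ "{z. z - y \<in> T}"]) auto
    qed
    then show "open_map euclidean euclidean u" by (simp add: open_map_def)
  qed
qed

section \<open>Multiplication by units\<close>

context topological_module
begin

lemma scale_zero_left: "scale 0 x = 0"
  using scale_left_distrib[of 0 0 x] by simp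

lemma tendsto_scale:
  assumes "(f \<longlongrightarrow> a) F" "(g \<longlongrightarrow> x) F"
  shows "((\<lambda>t. scale (f t) (g t)) \<longlongrightarrow> scale a x) F"
  using continuous_on_tendsto_compose[OF continuous_scale tendsto_Pair[OF assms]] by simp

lemma continuous_on_scale_right: "continuous_on A (scale a)"
  by (auto simp: continuous_on_def intro!: tendsto_scale tendsto_intros)

lemma null_units_absorb:
  assumes r: "r \<longlonglongrightarrow> 0" and W: "neighbourhood 0 W"
  shows "\<exists>i::nat. scale (r i) x \<in> W"
proof -
  obtain U where U: "open U" "0 \<in> U" "U \<subseteq> W" using W unfolding neighbourhood_def by blast
  have "(\<lambda>i. scale (r i) x) \<longlonglongrightarrow> 0"
    using tendsto_scale[OF r tendsto_const[of x]] by (simp add: scale_zero_left)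
  then have "\<forall>\<^sub>F i in sequentially. scale (r i) x \<in> U"
    using U by (simp add: topological_tendstoD)
  then show ?thesis using U by (auto simp: eventually_sequentially)
qed

text \<open>A unit acts as a homeomorphism, its inverse being the action of \<open>b\<close>.\<close>

lemma nowhere_dense_scale_unit:
  assumes ba: "b * a = 1" and ab: "a * b = 1" and A: "nowhere_dense A"
  shows "nowhere_dense (scale a ` A)"
proof (rule ccontr)
  assume "\<not> nowhere_dense (scale a ` A)"
  then obtain p where p: "p \<in> interior (closure (scale a ` A))"
    unfolding nowhere_dense_def by blast
  let ?O = "scale a -` interior (closure (scale a ` A))"
  have inv: "scale b (scale a z) = z" "scale a (scale b z) = z" for z
    by (simp_all add: scale_scale ba ab scale_one)
  have "open ?O" by (intro open_vimage open_interior continuous_on_scale_right)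
  moreover have "?O \<subseteq> closure A"
  proof
    fix z assume "z \<in> ?O"
    then have "scale a z \<in> closure (scale a ` A)" using interior_subset by blast
    then have "scale b (scale a z) \<in> closure (scale b ` scale a ` A)"
      using continuous_image_closure_subset[of UNIV "scale b" "scale a ` A"]
        continuous_on_scale_right by blast
    then show "z \<in> closure A" by (simp add: inv image_image)
  qed
  ultimately have "?O \<subseteq> interior (closure A)" by (rule interior_maximal[rotated])
  moreover have "scale b p \<in> ?O" using p by (simp add: inv)
  ultimately show False using A unfolding nowhere_dense_def by blast
qed

end

text \<open>
  A submodule that is a neighbourhood of \<open>0\<close> contains some \<open>r\<^sub>i y\<close> for every \<open>y\<close>, and so
  \<open>y = r\<^sub>i\<^sup>-\<^sup>1 (r\<^sub>i y)\<close>.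
\<close>

lemma surj_if_range_neighbourhood:
  fixes scaleN :: "'r::{ring, monoid_mult, topological_ab_group_add, topological_semigroup_mult}
      \<Rightarrow> 'n::topological_ab_group_add \<Rightarrow> 'n" and r :: "nat \<Rightarrow> 'r"
  assumes N: "topological_module scaleN"
    and linear: "module_linear scaleM scaleN u"
    and r: "\<And>i. ring_unit (r i)" "r \<longlonglongrightarrow> 0"
    and range: "neighbourhood 0 (range u)"
  shows "surj u"
proof -
  interpret N: topological_module scaleN by (rule N)
  have "y \<in> range u" for y
  proof -
    obtain i x where x: "scaleN (r i) y = u x"
      using N.null_units_absorb[OF r(2) range] by blast
    obtain b where b: "b * r i = 1" using r(1) unfolding ring_unit_def by blast
    have "u (scaleM b x) = scaleN b (scaleN (r i) y)"
      using linear x unfolding module_linear_def by simp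
    also have "\<dots> = y" by (simp add: N.scale_scale b N.scale_one)
    finally show ?thesis by (metis rangeI)
  qed
  then show ?thesis by blast
qed

text \<open>
  If \<open>W - W \<subseteq> V\<close>, the range is the union of the sets \<open>r\<^sub>i\<^sup>-\<^sup>1 u(W)\<close>, so some of them, and
  therefore \<open>u(W)\<close> itself, has a closure with nonempty interior. This interior contains some
  \<open>u(w)\<close> with \<open>w \<in> W\<close>; translating it by \<open>- u(w)\<close> gives a neighbourhood of \<open>0\<close> in the
  closure of \<open>u(W - w) \<subseteq> u(V)\<close>.
\<close>

lemma nonmeagre_range_nearly_open:
  fixes scaleM :: "'r::{ring, monoid_mult, topological_ab_group_add, topological_semigroup_mult}
      \<Rightarrow> 'm::topological_ab_group_add \<Rightarrow> 'm"
    and scaleN :: "'r \<Rightarrow> 'n::topological_ab_group_add \<Rightarrow> 'n" and r :: "nat \<Rightarrow> 'r"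
  assumes M: "topological_module scaleM" and N: "topological_module scaleN"
    and linear: "module_linear scaleM scaleN u"
    and r: "\<And>i. ring_unit (r i)" "r \<longlonglongrightarrow> 0"
    and nonmeagre: "\<not> meagre (range u)"
    and V: "neighbourhood 0 V"
  shows "neighbourhood 0 (closure (u ` V))"
proof -
  interpret M: topological_module scaleM by (rule M)
  interpret N: topological_module scaleN by (rule N)
  have add: "u (x + y) = u x + u y" and scale: "u (scaleM a x) = scaleN a (u x)" for x y a
    using linear unfolding module_linear_def by auto
  obtain V' where V': "open V'" "0 \<in> V'" "V' \<subseteq> V" using V unfolding neighbourhood_def by blast
  obtain W where W: "open W" "0 \<in> W" "\<And>a. a \<in> W \<Longrightarrow> - a \<in> W"
    "\<And>a b. a \<in> W \<Longrightarrow> b \<in> W \<Longrightarrow> a + b \<in> V'"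
    by (rule symmetric_halving_neighbourhood[OF V'(1,2)]) auto
  obtain b where b: "\<And>i. r i * b i = 1" "\<And>i. b i * r i = 1"
    using r(1) unfolding ring_unit_def by metis
  have "\<not> nowhere_dense (u ` W)"
  proof
    assume nd: "nowhere_dense (u ` W)"
    have "range u = (\<Union>i. scaleN (b i) ` u ` W)"
    proof (intro equalityI subsetI)
      fix y assume "y \<in> range u"
      then obtain x where x: "y = u x" by blast
      obtain i where i: "scaleM (r i) x \<in> W"
        using M.null_units_absorb[OF r(2) open_imp_neighbourhood[OF W(1,2)]] by blast
      have "y = scaleN (b i) (u (scaleM (r i) x))"
        by (simp add: scale N.scale_scale b N.scale_one x)
      then show "y \<in> (\<Union>i. scaleN (b i) ` u ` W)" using i by blast
    next
      fix y assume "y \<in> (\<Union>i. scaleN (b i) ` u ` W)"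
      then obtain i x where "y = scaleN (b i) (u x)" by blast
      then have "y = u (scaleM (b i) x)" by (simp only: scale)
      then show "y \<in> range u" by blast
    qed
    moreover have "nowhere_dense (scaleN (b i) ` u ` W)" for i
      using N.nowhere_dense_scale_unit[OF b nd] .
    ultimately have "meagre (range u)"
      unfolding meagre_def by (intro exI[of _ "range (\<lambda>i. scaleN (b i) ` u ` W)"]) auto
    with nonmeagre show False ..
  qed
  then obtain p where p: "p \<in> interior (closure (u ` W))" unfolding nowhere_dense_def by blast
  have "interior (closure (u ` W)) \<inter> u ` W \<noteq> {}"
    using p interior_subset[of "closure (u ` W)"]
      open_Int_closure_eq_empty[of "interior (closure (u ` W))" "u ` W"] by auto
  then obtain w where w: "w \<in> W" "u w \<in> interior (closure (u ` W))" by blast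
  let ?T = "(\<lambda>z. z + u w) -` interior (closure (u ` W))"
  have "open ?T" by (intro open_vimage open_interior continuous_intros)
  moreover have "0 \<in> ?T" using w by simp
  moreover have "?T \<subseteq> closure (u ` V)"
  proof
    fix z assume "z \<in> ?T"
    then have "z + u w \<in> closure (u ` W)" using interior_subset by blast
    moreover have "continuous_on UNIV (\<lambda>t. t - u w)" by (intro continuous_intros)
    ultimately have "z + u w - u w \<in> closure ((\<lambda>t. t - u w) ` u ` W)"
      using continuous_image_closure_subset[of UNIV "\<lambda>t. t - u w" "u ` W"] by blast
    moreover have "(\<lambda>t. t - u w) ` u ` W \<subseteq> u ` V"
    proof
      fix t assume "t \<in> (\<lambda>t. t - u w) ` u ` W"
      then obtain v where v: "v \<in> W" "t = u v - u w" by blast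
      have "u (v + - w + w) = u (v + - w) + u w" by (rule add)
      then have "u v = u (v + - w) + u w" by (simp only: add.assoc left_minus add_0_right)
      then have "u v - u w = u (v + - w)" by (simp only: diff_eq_eq)
      then have "t = u (v + - w)" by (simp only: v(2))
      moreover have "v + - w \<in> V" using W(4)[OF v(1) W(3)[OF w(1)]] V'(3) by (rule subsetD[rotated])
      ultimately show "t \<in> u ` V" by blast
    qed
    ultimately show "z \<in> closure (u ` V)"
      using closure_mono[of "(\<lambda>t. t - u w) ` u ` W" "u ` V"] by auto
  qed
  ultimately show ?thesis unfolding neighbourhood_def by blast
qed

section \<open>The open mapping theorem\<close>

theorem theorem0p1:
  fixes scaleM :: "'r::{ring, monoid_mult, topological_ab_group_add, topological_semigroup_mult}
      \<Rightarrow> 'm::{topological_ab_group_add, t2_space} \<Rightarrow> 'm"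
    and scaleN :: "'r \<Rightarrow> 'n::{topological_ab_group_add, t2_space} \<Rightarrow> 'n"
    and u :: "'m \<Rightarrow> 'n"
  assumes units: "\<exists>r :: nat \<Rightarrow> 'r. (\<forall>i. ring_unit (r i)) \<and> r \<longlonglongrightarrow> 0"
    and M: "topological_module scaleM"
    and N: "topological_module scaleN"
    and baseM: "countable_neighbourhood_base (0 :: 'm)"
    and baseN: "countable_neighbourhood_base (0 :: 'n)"
    and completeM: "group_complete TYPE('m)"
    and linear: "module_linear scaleM scaleN u"
    and continuous: "continuous_on UNIV u"
  shows "(group_complete TYPE('n) \<and> surj u \<longleftrightarrow> group_complete TYPE('n) \<and> open (range u))
    \<and> (group_complete TYPE('n) \<and> open (range u) \<longleftrightarrow> \<not> meagre (range u))
    \<and> (\<not> meagre (range u) \<longleftrightarrow>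
        (\<forall>V. neighbourhood 0 V \<longrightarrow> neighbourhood 0 (closure (u ` V))))
    \<and> ((\<forall>V. neighbourhood 0 V \<longrightarrow> neighbourhood 0 (closure (u ` V))) \<longleftrightarrow>
        open_map euclidean euclidean u)"
proof -
  obtain r :: "nat \<Rightarrow> 'r" where r: "\<And>i. ring_unit (r i)" "r \<longlonglongrightarrow> 0" using units by blast
  have add: "u (x + y) = u x + u y" for x y using linear unfolding module_linear_def by blast
  have u0: "u 0 = 0" using add[of 0 0] by simp
  let ?nearly = "\<forall>V. neighbourhood 0 V \<longrightarrow> neighbourhood 0 (closure (u ` V))"
  have c1_1a: "surj u \<longleftrightarrow> open (range u)"
  proof
    assume "open (range u)"
    then have "neighbourhood 0 (range u)" using u0 by (metis open_imp_neighbourhood rangeI)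
    then show "surj u" by (rule surj_if_range_neighbourhood[OF N linear r])
  qed simp
  have c1_2: "\<not> meagre (range u)" if "group_complete TYPE('n)" "surj u"
    using complete_group_not_meagre[OF baseN that(1)] that(2) by simp
  have c2_3: ?nearly if "\<not> meagre (range u)"
    using nonmeagre_range_nearly_open[OF M N linear r that] by blast
  have c3_4: "open_map euclidean euclidean u" if ?nearly
    using nearly_open_imp_open[OF baseM baseN completeM continuous add] that
    unfolding open_map_iff_neighbourhood_0[OF add] by blast
  have c4_1: "group_complete TYPE('n) \<and> surj u" if "open_map euclidean euclidean u"
  proof
    have nb: "neighbourhood 0 (u ` V)" if "neighbourhood 0 V" for V
      using that \<open>open_map euclidean euclidean u\<close> open_map_iff_neighbourhood_0[OF add] by blast
    then show "group_complete TYPE('n)"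
      by (rule complete_open_image[OF baseM completeM continuous add])
    have "neighbourhood 0 (range u)" by (rule nb) (simp add: open_imp_neighbourhood)
    then show "surj u" by (rule surj_if_range_neighbourhood[OF N linear r])
  qed
  show ?thesis using c1_1a c1_2 c2_3 c3_4 c4_1 by blast
qed

end
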